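(* Let $n,a_1,b_1,a_2,b_2$ be positive integers with $a_1b_1\mid n$ and $a_2b_2\mid n$, and let $G=C(n;a_1,b_1;a_2,b_2)$ be the $2$-paired circulant of order $n$ generated by $a_1,b_1,a_2,b_2$. Suppose that $G$ is connected and co-connected. Then $G$ is CIS if and only if $\gcd(a_1b_1,a_2b_2)=1$.
   Context: Graphs are finite, undirected, without loops or multiple edges. For a positive integer $n$ write $[n]=\{1,\dots,n\}$, and $[0]=\emptyset$. Given a positive integer $n$ and a set $D\subseteq[n-1]$ such that $d\in D\Leftrightarrow n-d\in D$, the circulant $C_n(D)$ is the graph with vertex set $\mathbb{Z}_n$ in which two distinct vertices $i,j$ are adjacent if and only if $i-j \pmod n\in D$. For positive integers $a_i,b_i$ with $a_ib_i\mid n$ ($i=1,2$), $C(n;a_1,b_1;a_2,b_2)$ denotes the circulant $C_n(D)$ with $D=D_1\cup D_2$, where $D_i=\{d\in[n-1] : a_i\mid d \text{ and } a_ib_i\nmid d\}$. A graph is co-connected if its complement is connected. A graph is CIS if every inclusion-maximal clique and every inclusion-maximal stable set (set of pairwise non-adjacent vertices) of it have a common vertex. *)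

theory Defs
  imports "Graph_Theory.Graph_Theory"
begin

text \<open>
  Simple graphs are modelled, following the Graph-Theory library, as symmetric loop-free
  digraphs whose arcs are ordered pairs of vertices (locale \<^locale>\<open>pair_graph\<close>).
\<close>

definition graph_complement :: "'a pair_pre_digraph \<Rightarrow> 'a pair_pre_digraph" where
  "graph_complement G =
     \<lparr> pverts = pverts G,
       parcs = {(u, v). u \<in> pverts G \<and> v \<in> pverts G \<and> u \<noteq> v \<and> (u, v) \<notin> parcs G} \<rparr>"

text \<open>
  The library predicate requires a nonempty vertex set; this is harmless here because
  circulants of positive order are nonempty.
\<close>

definition graph_connected :: "'a pair_pre_digraph \<Rightarrow> bool" where
  "graph_connected G \<longleftrightarrow> Digraph_Component.connected (with_proj G)"

definition co_connected :: "'a pair_pre_digraph \<Rightarrow> bool" where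
  "co_connected G \<longleftrightarrow> graph_connected (graph_complement G)"

definition clique :: "'a pair_pre_digraph \<Rightarrow> 'a set \<Rightarrow> bool" where
  "clique G C \<longleftrightarrow> C \<subseteq> pverts G \<and> (\<forall>u\<in>C. \<forall>v\<in>C. u \<noteq> v \<longrightarrow> (u, v) \<in> parcs G)"

definition stable_set :: "'a pair_pre_digraph \<Rightarrow> 'a set \<Rightarrow> bool" where
  "stable_set G S \<longleftrightarrow> S \<subseteq> pverts G \<and> (\<forall>u\<in>S. \<forall>v\<in>S. (u, v) \<notin> parcs G)"

definition maximal_clique :: "'a pair_pre_digraph \<Rightarrow> 'a set \<Rightarrow> bool" where
  "maximal_clique G C \<longleftrightarrow> clique G C \<and> (\<forall>C'. clique G C' \<longrightarrow> \<not> C \<subset> C')"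

definition maximal_stable_set :: "'a pair_pre_digraph \<Rightarrow> 'a set \<Rightarrow> bool" where
  "maximal_stable_set G S \<longleftrightarrow> stable_set G S \<and> (\<forall>S'. stable_set G S' \<longrightarrow> \<not> S \<subset> S')"

definition CIS :: "'a pair_pre_digraph \<Rightarrow> bool" where
  "CIS G \<longleftrightarrow> (\<forall>C S. maximal_clique G C \<and> maximal_stable_set G S \<longrightarrow> C \<inter> S \<noteq> {})"

text \<open>
  The vertex set \<open>\<int>\<^sub>n\<close> is represented by the residues \<open>0, \<dots>, n - 1\<close>.  The differences are taken in
  the integers, so \<open>(i - j) mod int n\<close> is the residue of \<open>i - j\<close> in that range.
\<close>

definition circulant :: "nat \<Rightarrow> nat set \<Rightarrow> int pair_pre_digraph" where
  "circulant n D =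
     \<lparr> pverts = {0..<int n},
       parcs = {(i, j). i \<in> {0..<int n} \<and> j \<in> {0..<int n} \<and> i \<noteq> j \<and>
                        nat ((i - j) mod int n) \<in> D} \<rparr>"

definition paired_set :: "nat \<Rightarrow> nat \<Rightarrow> nat \<Rightarrow> nat set" where
  "paired_set n a b = {d \<in> {1..n - 1}. a dvd d \<and> \<not> a * b dvd d}"

definition two_paired_circulant ::
    "nat \<Rightarrow> nat \<Rightarrow> nat \<Rightarrow> nat \<Rightarrow> nat \<Rightarrow> int pair_pre_digraph" where
  "two_paired_circulant n a1 b1 a2 b2 =
     circulant n (paired_set n a1 b1 \<union> paired_set n a2 b2)"

lemma pair_graph_circulant:
  assumes D: "\<And>d. d \<in> {1..n - 1} \<Longrightarrow> d \<in> D \<longleftrightarrow> n - d \<in> D"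
  shows "pair_graph (circulant n D)"
proof -
  have sym: "nat ((j - i) mod int n) \<in> D"
    if ij: "i \<in> {0..<int n}" "j \<in> {0..<int n}" "i \<noteq> j" and d: "nat ((i - j) mod int n) \<in> D"
    for i j
  proof -
    define d where "d = nat ((i - j) mod int n)"
    have n: "int n > 0" using ij by auto
    have nz: "(i - j) mod int n \<noteq> 0"
    proof
      assume "(i - j) mod int n = 0"
      hence "i mod int n = j mod int n" by (simp add: mod_eq_dvd_iff dvd_eq_mod_eq_0)
      thus False using ij by simp
    qed
    have ge: "(i - j) mod int n \<ge> 0" and lt: "(i - j) mod int n < int n" using n by auto
    have "(j - i) mod int n = int n - (i - j) mod int n"
      using nz zmod_zminus1_eq_if[of "i - j" "int n"] by simp
    hence eq: "nat ((j - i) mod int n) = n - d" unfolding d_def using ge lt by simp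
    have "d \<in> {1..n - 1}" unfolding d_def using nz ge lt by auto
    with D[of d] d eq show ?thesis by (simp add: d_def)
  qed
  show ?thesis
  proof
    show "finite (parcs (circulant n D))"
      by (rule finite_subset[of _ "{0..<int n} \<times> {0..<int n}"]) (auto simp: circulant_def)
    show "symmetric (with_proj (circulant n D))"
      unfolding symmetric_def sym_def with_proj_simps
      by (auto simp: circulant_def intro: sym)
  qed (auto simp: circulant_def)
qed

lemma paired_set_sym:
  assumes "a * b dvd n" "d \<in> {1..n - 1}"
  shows "d \<in> paired_set n a b \<longleftrightarrow> n - d \<in> paired_set n a b"
proof -
  have dn: "d \<le> n" and "n - d \<in> {1..n - 1}" using assms(2) by auto
  have "a dvd n" using assms(1) dvd_mult_left by blast
  hence "a dvd d \<longleftrightarrow> a dvd n - d" using dn dvd_diffD dvd_diff_nat dvd_diffD1 by metis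
  moreover have "a * b dvd d \<longleftrightarrow> a * b dvd n - d"
    using assms(1) dn dvd_diffD dvd_diff_nat dvd_diffD1 by metis
  ultimately show ?thesis
    using assms(2) \<open>n - d \<in> {1..n - 1}\<close> by (simp add: paired_set_def)
qed

lemma pair_graph_two_paired_circulant:
  assumes "a1 * b1 dvd n" "a2 * b2 dvd n"
  shows "pair_graph (two_paired_circulant n a1 b1 a2 b2)"
  unfolding two_paired_circulant_def
  by (rule pair_graph_circulant) (use assms paired_set_sym in blast)

end

theory Submission
  imports Defs "HOL-Computational_Algebra.Primes"
begin

text \<open>
  Write \<open>A\<^sub>i = a\<^sub>i b\<^sub>i\<close>.  Two vertices are adjacent iff for some \<open>i\<close> they agree modulo \<open>a\<^sub>i\<close> but not
  modulo \<open>A\<^sub>i\<close>; call this an edge of type \<open>i\<close>.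

  Suppose \<open>gcd A\<^sub>1 A\<^sub>2 = 1\<close>.  On a clique \<open>C\<close> the congruences modulo \<open>a\<^sub>1\<close> and modulo \<open>a\<^sub>2\<close> together
  relate all pairs, and a set is never covered by two equivalence relations unless one of them is
  already total (\<open>total_congruence_of_union\<close>).  So \<open>C\<close> lies in one class modulo \<open>a\<^sub>1\<close>, say.  By the
  Chinese remainder theorem the residues modulo \<open>A\<^sub>1\<close> and modulo \<open>A\<^sub>2\<close> are independent, which makes a
  maximal stable set \<open>S\<close> a full product: it meets every class modulo \<open>a\<^sub>1\<close> and every class modulo
  \<open>a\<^sub>2\<close> (\<open>stable_set_meets_class\<close>), and residues of its members can be combined freely
  (\<open>stable_set_combine\<close>).  Likewise a maximal \<open>C\<close> has all residues modulo \<open>A\<^sub>1\<close> that its class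
  modulo \<open>a\<^sub>1\<close> admits.  Choosing first the residue modulo \<open>A\<^sub>1\<close>
  and then the one modulo \<open>A\<^sub>2\<close> as \<open>S\<close> prescribes yields a common vertex (\<open>clique_meets_stable_set\<close>).

  Suppose \<open>gcd A\<^sub>1 A\<^sub>2 > 1\<close>.  Connectedness and co-connectedness force
  \<open>a\<^sub>1, b\<^sub>1, a\<^sub>2, b\<^sub>2 > 1\<close> and \<open>gcd a\<^sub>1 a\<^sub>2 = 1\<close>.  It suffices to exhibit a clique and a stable set such that
  every vertex that belongs or could be added to the clique has a neighbour in the stable set
  (\<open>not_CIS_if_dominated\<close>).  The clique is always \<open>{0, a\<^sub>1, \<dots>, (b\<^sub>1 - 1) a\<^sub>1}\<close>, up to exchanging the
  indices.  If a prime \<open>p\<close> divides \<open>A\<^sub>1\<close> and \<open>b\<^sub>2\<close> but not \<open>a\<^sub>2\<close>, and \<open>a\<^sub>2\<close> does not divide \<open>b\<^sub>1\<close>, then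
  the stable set \<open>{A\<^sub>1, a\<^sub>2}\<close> works (\<open>not_CIS_common_prime\<close>).  Such a prime exists, possibly after
  exchanging the indices, unless \<open>a\<^sub>1\<close> divides \<open>b\<^sub>2\<close> and \<open>a\<^sub>2\<close> divides \<open>b\<^sub>1\<close>; in that case the larger
  of \<open>a\<^sub>1, a\<^sub>2\<close> leaves enough room for a stable set that avoids the class of \<open>0\<close> modulo it and meets
  all classes modulo the other one (\<open>not_CIS_mutual_dvd\<close>).
\<close>

section \<open>Maximal cliques and maximal stable sets\<close>

lemma maximal_clique_absorbs:
  assumes "maximal_clique G C" "v \<in> pverts G"
    and "\<And>c. c \<in> C \<Longrightarrow> c \<noteq> v \<Longrightarrow> (v, c) \<in> parcs G \<and> (c, v) \<in> parcs G"
  shows "v \<in> C"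
proof -
  have "clique G (insert v C)"
    using assms unfolding maximal_clique_def clique_def by blast
  then show ?thesis
    using assms(1) unfolding maximal_clique_def by blast
qed

lemma maximal_stable_set_absorbs:
  assumes "maximal_stable_set G S" "v \<in> pverts G" "(v, v) \<notin> parcs G"
    and "\<And>s. s \<in> S \<Longrightarrow> (v, s) \<notin> parcs G \<and> (s, v) \<notin> parcs G"
  shows "v \<in> S"
proof -
  have "stable_set G (insert v S)"
    using assms unfolding maximal_stable_set_def stable_set_def by blast
  then show ?thesis
    using assms(1) unfolding maximal_stable_set_def by blast
qed

lemma clique_extends:
  assumes "finite (pverts G)" "clique G C"
  obtains C' where "maximal_clique G C'" "C \<subseteq> C'"
proof -
  have "finite {C. clique G C}"
    by (rule finite_subset[of _ "Pow (pverts G)"]) (auto simp: clique_def assms(1))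
  then obtain M where "clique G M" "C \<subseteq> M" "\<forall>B. clique G B \<longrightarrow> M \<subseteq> B \<longrightarrow> M = B"
    using finite_has_maximal2[of "{C. clique G C}" C] assms(2) by auto
  then show thesis
    by (intro that[of M]) (auto simp: maximal_clique_def)
qed

lemma stable_set_extends:
  assumes "finite (pverts G)" "stable_set G S"
  obtains S' where "maximal_stable_set G S'" "S \<subseteq> S'"
proof -
  have "finite {S. stable_set G S}"
    by (rule finite_subset[of _ "Pow (pverts G)"]) (auto simp: stable_set_def assms(1))
  then obtain M where "stable_set G M" "S \<subseteq> M" "\<forall>B. stable_set G B \<longrightarrow> M \<subseteq> B \<longrightarrow> M = B"
    using finite_has_maximal2[of "{S. stable_set G S}" S] assms(2) by auto
  then show thesis
    by (intro that[of M]) (auto simp: maximal_stable_set_def)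
qed

text \<open>
  A common vertex of maximal extensions of \<open>C\<close> and \<open>S\<close> would be joined to the rest of \<open>C\<close> and to
  nothing in \<open>S\<close>.
\<close>

lemma not_CIS_if_dominated:
  assumes "finite (pverts G)" "clique G C" "stable_set G S"
    and dom: "\<And>x. x \<in> pverts G \<Longrightarrow> (\<And>c. c \<in> C \<Longrightarrow> c \<noteq> x \<Longrightarrow> (x, c) \<in> parcs G)
               \<Longrightarrow> \<exists>s\<in>S. (x, s) \<in> parcs G"
  shows "\<not> CIS G"
proof
  assume "CIS G"
  obtain C' where C': "maximal_clique G C'" "C \<subseteq> C'"
    using clique_extends assms(1,2) by blast
  obtain S' where S': "maximal_stable_set G S'" "S \<subseteq> S'"
    using stable_set_extends assms(1,3) by blast
  obtain x where x: "x \<in> C'" "x \<in> S'"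
    using \<open>CIS G\<close> C'(1) S'(1) unfolding CIS_def by blast
  have C'_clique: "C' \<subseteq> pverts G" "\<And>u v. u \<in> C' \<Longrightarrow> v \<in> C' \<Longrightarrow> u \<noteq> v \<Longrightarrow> (u, v) \<in> parcs G"
    using C'(1) by (auto simp: maximal_clique_def clique_def)
  have "\<exists>s\<in>S. (x, s) \<in> parcs G"
    by (rule dom) (use C'_clique C'(2) x(1) in auto)
  then obtain s where "s \<in> S" "(x, s) \<in> parcs G"
    by blast
  then show False
    using S' x(2) unfolding maximal_stable_set_def stable_set_def by blast
qed

text \<open>
  If every arc respects a congruence, so does every walk; this is how connectedness bounds the
  parameters of a circulant.
\<close>

lemma graph_connected_dvd_diff:
  fixes G :: "int pair_pre_digraph" and m :: int
  assumes "graph_connected G" "u \<in> pverts G" "v \<in> pverts G"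
    and arcs: "\<And>x y. (x, y) \<in> parcs G \<Longrightarrow> m dvd x - y"
  shows "m dvd u - v"
proof -
  let ?H = "mk_symmetric (with_proj G)"
  have step: "m dvd x - y" if "(x, y) \<in> parcs ?H" for x y
  proof -
    have "(x, y) \<in> parcs G \<or> (y, x) \<in> parcs G"
      using that by (auto simp: mk_symmetric_def)
    then show ?thesis
      using arcs dvd_diff_commute by blast
  qed
  have "(u, v) \<in> rtrancl_on (pverts ?H) (parcs ?H)"
    using assms(1-3)
    by (auto simp: graph_connected_def Digraph_Component.connected_def strongly_connected_def
        reachable_def mk_symmetric_def)
  then show ?thesis
  proof (induction rule: rtrancl_on_induct)
    case base
    then show ?case by simp
  next
    case (step y z)
    have "m dvd (u - y) + (y - z)"
      using step.IH \<open>\<And>x y. (x, y) \<in> parcs ?H \<Longrightarrow> m dvd x - y\<close>[OF step.hyps(2)] by (rule dvd_add)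
    then show ?case by simp
  qed
qed

section \<open>Congruences\<close>

lemma dvd_diff_trans:
  fixes m x y z :: "'a :: comm_ring_1"
  assumes "m dvd x - y" "m dvd y - z"
  shows "m dvd x - z"
  using dvd_add[OF assms] by simp

lemma not_dvd_if_coprime:
  fixes a b :: nat
  assumes "coprime a b" "a > 1"
  shows "\<not> a dvd b"
  using assms by (auto simp: coprime_iff_gcd_eq_1 gcd_nat.absorb1)

lemma crt_in_interval:
  fixes A B n s t :: int
  assumes "coprime A B" "A dvd n" "B dvd n" "n > 0"
  obtains v where "v \<in> {0..<n}" "A dvd v - s" "B dvd v - t"
proof -
  obtain x y where xy: "x * A + y * B = 1"
    using bezout_int[of A B] assms(1) by auto
  define w where "w = s + x * A * (t - s)"
  have "w - t = (s - t) * (1 - x * A)"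
    by (simp add: w_def algebra_simps)
  also have "1 - x * A = y * B"
    using xy by simp
  finally have wt: "B dvd w - t" by simp
  have ws: "A dvd w - s" by (simp add: w_def)
  have red: "m dvd w mod n - r" if "m dvd n" "m dvd w - r" for m r
  proof -
    have "m dvd w mod n - w"
      using that(1) by (simp add: dvd_diff_commute[of _ "w mod n"] minus_mod_eq_mult_div)
    then show ?thesis using that(2) by (rule dvd_diff_trans)
  qed
  show thesis
    by (rule that[of "w mod n"]) (use assms red ws wt in auto)
qed

text \<open>
  The argument is that of the group theorem that no group is the union of two proper subgroups; of
  the congruences only symmetry and transitivity matter.
\<close>

lemma total_congruence_of_union:
  fixes p q :: int
  assumes "\<And>x y. x \<in> C \<Longrightarrow> y \<in> C \<Longrightarrow> p dvd x - y \<or> q dvd x - y"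
  shows "(\<forall>x\<in>C. \<forall>y\<in>C. p dvd x - y) \<or> (\<forall>x\<in>C. \<forall>y\<in>C. q dvd x - y)"
proof (rule ccontr)
  assume "\<not> ?thesis"
  then obtain x y z w where C: "x \<in> C" "y \<in> C" "z \<in> C" "w \<in> C"
    and xy: "\<not> p dvd x - y" and zw: "\<not> q dvd z - w" by blast
  have sy: "m dvd v - u" if "m dvd u - v" for m u v :: int
    using that dvd_diff_commute by blast
  have pzw: "p dvd z - w" using assms C zw by blast
  show False
  proof (cases "p dvd x - z")
    case True
    then have "\<not> p dvd y - z" "\<not> p dvd y - w"
      using xy pzw dvd_diff_trans sy by meson+
    then show False using assms C zw dvd_diff_trans sy by meson
  next
    case False
    then have "\<not> p dvd x - w" using pzw dvd_diff_trans sy by meson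
    then show False using False assms C zw dvd_diff_trans sy by meson
  qed
qed

text \<open>The differences that carry an edge of the type given by \<open>a\<close> and \<open>b\<close>.\<close>

definition linked :: "nat \<Rightarrow> nat \<Rightarrow> int \<Rightarrow> bool" where
  "linked a b d \<longleftrightarrow> int a dvd d \<and> \<not> int (a * b) dvd d"

lemma linked_minus [simp]: "linked a b (- d) \<longleftrightarrow> linked a b d"
  by (simp add: linked_def)

lemma linked_commute: "linked a b (x - y) \<longleftrightarrow> linked a b (y - x)"
  using linked_minus[of a b "x - y"] by simp

lemma linked_0 [simp]: "\<not> linked a b 0"
  by (simp add: linked_def)

lemma linked_dvd: "linked a b d \<Longrightarrow> int a dvd d"
  by (simp add: linked_def)

lemma linked_shift:
  assumes "int (a * b) dvd v - s"
  shows "linked a b (v - x) \<longleftrightarrow> linked a b (s - x)"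
proof -
  have "int a dvd v - s" using assms by (metis dvd_mult_left of_nat_mult)
  have "m dvd v - x \<longleftrightarrow> m dvd s - x" if "m dvd v - s" for m
    using dvd_add_right_iff[OF that, of "s - x"] by simp
  from this[OF assms] this[OF \<open>int a dvd v - s\<close>] show ?thesis
    by (simp add: linked_def)
qed

lemma mem_paired_set_iff_linked:
  fixes d :: int
  assumes "n > 0" "a * b dvd n"
  shows "nat (d mod int n) \<in> paired_set n a b \<longleftrightarrow> linked a b d"
proof -
  have red: "m dvd nat (d mod int n) \<longleftrightarrow> int m dvd d" if "m dvd n" for m
  proof -
    have "m dvd nat (d mod int n) \<longleftrightarrow> int m dvd d mod int n"
      using assms(1) by (subst int_dvd_int_iff[symmetric]) simp
    also have "\<dots> \<longleftrightarrow> int m dvd d"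
      using that by (simp add: dvd_mod_iff)
    finally show ?thesis .
  qed
  have "nat (d mod int n) < n"
    using assms(1) by (simp add: nat_less_iff)
  moreover have "a dvd n" using assms(2) dvd_mult_left by blast
  moreover have "nat (d mod int n) \<noteq> 0" if "\<not> a * b dvd nat (d mod int n)"
    using that by (metis dvd_0_right)
  ultimately show ?thesis
    using red[of a] red[of "a * b"] assms(2)
    by (auto simp: paired_set_def linked_def)
qed

section \<open>Two-paired circulants\<close>

locale two_paired =
  fixes n a1 b1 a2 b2 :: nat
  assumes n_pos: "n > 0" and dvd1: "a1 * b1 dvd n" and dvd2: "a2 * b2 dvd n"
begin

abbreviation G :: "int pair_pre_digraph" where
  "G \<equiv> two_paired_circulant n a1 b1 a2 b2"

lemma swap: "two_paired n a2 b2 a1 b1"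
  using n_pos dvd1 dvd2 by unfold_locales

lemma G_swap: "two_paired_circulant n a2 b2 a1 b1 = G"
  by (simp add: two_paired_circulant_def Un_commute)

lemma pverts_G [simp]: "pverts G = {0..<int n}"
  by (simp add: two_paired_circulant_def circulant_def)

lemma arc_iff:
  "(u, v) \<in> parcs G \<longleftrightarrow> u \<in> {0..<int n} \<and> v \<in> {0..<int n} \<and>
     (linked a1 b1 (u - v) \<or> linked a2 b2 (u - v))"
  using mem_paired_set_iff_linked[OF n_pos dvd1] mem_paired_set_iff_linked[OF n_pos dvd2]
  by (auto simp: two_paired_circulant_def circulant_def)

lemma moduli_dvd: "int (a1 * b1) dvd int n" "int (a2 * b2) dvd int n"
    "int a1 dvd int n" "int a2 dvd int n"
  using dvd1 dvd2 dvd_mult_left int_dvd_int_iff by blast+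

subsection \<open>Coprime moduli\<close>

lemma maximal_stable_setD:
  assumes "maximal_stable_set G S" "s \<in> S" "t \<in> S"
  shows "\<not> linked a1 b1 (s - t)" "\<not> linked a2 b2 (s - t)"
  using assms by (auto simp: maximal_stable_set_def stable_set_def arc_iff subset_iff)

lemma stable_set_memI:
  assumes "maximal_stable_set G S" "v \<in> {0..<int n}"
    and "\<And>s. s \<in> S \<Longrightarrow> \<not> linked a1 b1 (v - s) \<and> \<not> linked a2 b2 (v - s)"
  shows "v \<in> S"
  by (rule maximal_stable_set_absorbs[OF assms(1)])
    (use assms(2,3) in \<open>auto simp: arc_iff linked_commute\<close>)

lemma stable_set_combine:
  assumes "maximal_stable_set G S" "s \<in> S" "t \<in> S" "v \<in> {0..<int n}"
    and "int (a1 * b1) dvd v - s" "int (a2 * b2) dvd v - t"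
  shows "v \<in> S"
proof (rule stable_set_memI[OF assms(1,4)])
  fix x assume "x \<in> S"
  then show "\<not> linked a1 b1 (v - x) \<and> \<not> linked a2 b2 (v - x)"
    using assms(2,3) maximal_stable_setD[OF assms(1)]
      linked_shift[OF assms(5)] linked_shift[OF assms(6)] by blast
qed

text \<open>
  If \<open>S\<close> missed the class of \<open>r\<close>, then a vertex of that class which copies some member of \<open>S\<close> modulo
  \<open>a2 * b2\<close> could be added to \<open>S\<close>.
\<close>

lemma stable_set_meets_class:
  assumes "maximal_stable_set G S" "coprime (a1 * b1) (a2 * b2)"
  obtains s where "s \<in> S" "int a1 dvd s - r"
proof (rule ccontr)
  assume "\<not> thesis"
  then have miss: "\<not> int a1 dvd s - r" if "s \<in> S" for s
    using that \<open>\<And>s. s \<in> S \<Longrightarrow> int a1 dvd s - r \<Longrightarrow> thesis\<close> by blast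
  (* t is junk if S is empty; every vertex could then be added to S *)
  define t where "t = (SOME t. t \<in> S)"
  have t: "t \<in> S" if "s \<in> S" for s
    using that unfolding t_def by (rule someI)
  obtain v where v: "v \<in> {0..<int n}" "int (a1 * b1) dvd v - r" "int (a2 * b2) dvd v - t"
    using crt_in_interval[of "int (a1 * b1)" "int (a2 * b2)" "int n"] assms(2) moduli_dvd n_pos
    by (metis coprime_int_iff of_nat_0_less_iff)
  have vr: "int a1 dvd v - r" using v(2) by (metis dvd_mult_left of_nat_mult)
  have "v \<in> S"
  proof (rule stable_set_memI[OF assms(1) v(1)], intro conjI)
    fix s assume s: "s \<in> S"
    show "\<not> linked a1 b1 (v - s)"
    proof
      assume "linked a1 b1 (v - s)"
      then have "int a1 dvd s - v" by (metis linked_commute linked_dvd)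
      then show False using miss[OF s] vr dvd_diff_trans by blast
    qed
    show "\<not> linked a2 b2 (v - s)"
      using linked_shift[OF v(3)] maximal_stable_setD(2)[OF assms(1) t[OF s] s] by blast
  qed
  then show False using miss vr by blast
qed

text \<open>
  The residue modulo \<open>a1 * b1\<close> is dictated by the member \<open>s1\<close> of \<open>S\<close> in the class of \<open>C\<close>.  Maximality
  of \<open>C\<close> gives a \<open>c0\<close> in \<open>C\<close> with that residue, and the class of \<open>c0\<close> modulo \<open>a2\<close> determines the
  member \<open>s2\<close> of \<open>S\<close> that dictates the residue modulo \<open>a2 * b2\<close>.
\<close>

lemma common_class_clique_meets_stable_set:
  assumes C: "maximal_clique G C" and S: "maximal_stable_set G S"
    and cop: "coprime (a1 * b1) (a2 * b2)"
    and cls: "\<forall>x\<in>C. \<forall>y\<in>C. int a1 dvd x - y"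
  shows "C \<inter> S \<noteq> {}"
proof -
  interpret sw: two_paired n a2 b2 a1 b1 by (rule swap)
  have adj: "linked a1 b1 (x - y) \<or> linked a2 b2 (x - y)" if "x \<in> C" "y \<in> C" "x \<noteq> y" for x y
    using C that by (auto simp: maximal_clique_def clique_def arc_iff)
  have sub: "C \<subseteq> {0..<int n}" "S \<subseteq> {0..<int n}"
    using C S by (auto simp: maximal_clique_def clique_def maximal_stable_set_def stable_set_def)
  have absorb: "v \<in> C" if "v \<in> {0..<int n}"
    and "\<And>c. c \<in> C \<Longrightarrow> c \<noteq> v \<Longrightarrow> linked a1 b1 (v - c) \<or> linked a2 b2 (v - c)" for v
    by (rule maximal_clique_absorbs[OF C]) (use that sub in \<open>auto simp: arc_iff linked_commute\<close>)
  obtain r where r: "\<And>c. c \<in> C \<Longrightarrow> int a1 dvd c - r"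
    using cls by (cases "C = {}") auto
  obtain s1 where s1: "s1 \<in> S" "int a1 dvd s1 - r"
    using stable_set_meets_class[OF S cop] by blast
  have s1C: "int a1 dvd s1 - c" if "c \<in> C" for c
    using dvd_diff[OF s1(2) r[OF that]] by simp
  obtain c0 where c0: "c0 \<in> C" "int (a1 * b1) dvd s1 - c0"
  proof (cases "\<exists>c\<in>C. int (a1 * b1) dvd s1 - c")
    case False
    then have "s1 \<in> C"
      using s1 sub s1C by (intro absorb) (auto simp: linked_def)
    then show thesis using that[of s1] by simp
  qed (use that in blast)
  obtain s2 where s2: "s2 \<in> S" "int a2 dvd s2 - c0"
    using sw.stable_set_meets_class[unfolded G_swap, OF S] cop by (metis coprime_commute)
  obtain v where v: "v \<in> {0..<int n}" "int (a1 * b1) dvd v - s1" "int (a2 * b2) dvd v - s2"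
    using crt_in_interval[of "int (a1 * b1)" "int (a2 * b2)" "int n"] cop moduli_dvd n_pos
    by (metis coprime_int_iff of_nat_0_less_iff)
  have vc0: "int a2 dvd v - c0"
  proof -
    have "int a2 dvd v - s2" using v(3) by (metis dvd_mult_left of_nat_mult)
    then show ?thesis using s2(2) by (rule dvd_diff_trans)
  qed
  show ?thesis
  (* v itself may fail to lie in C, namely when C contains a vertex with the same two residues *)
  proof (cases "\<exists>c\<in>C. int (a1 * b1) dvd c - v \<and> int (a2 * b2) dvd c - v")
    case True
    then obtain c where c: "c \<in> C" "int (a1 * b1) dvd c - v" "int (a2 * b2) dvd c - v" by blast
    have "int (a1 * b1) dvd c - s1" "int (a2 * b2) dvd c - s2"
      using c(2,3) v(2,3) dvd_diff_trans by blast+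
    then have "c \<in> S"
      using stable_set_combine[OF S s1(1) s2(1)] c(1) sub by blast
    then show ?thesis using c(1) by blast
  next
    case False
    have "v \<in> C"
    proof (rule absorb[OF v(1)])
      fix c assume c: "c \<in> C" "c \<noteq> v"
      have "linked a1 b1 (v - c) = linked a1 b1 (s1 - c)"
        by (rule linked_shift[OF v(2)])
      moreover have "linked a2 b2 (v - c)" if "int (a1 * b1) dvd s1 - c"
      proof -
        have c0c: "int (a1 * b1) dvd c0 - c"
          using dvd_diff[OF that c0(2)] by simp
        then have "int a2 dvd c0 - c"
          using adj[OF c0(1) c(1)] by (cases "c0 = c") (auto simp: linked_def)
        then have "int a2 dvd v - c"
          using vc0 dvd_diff_trans by blast
        moreover have "int (a1 * b1) dvd v - c"
          using v(2) that by (rule dvd_diff_trans)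
        ultimately show ?thesis
          using False c(1) by (auto simp: linked_def dvd_diff_commute)
      qed
      ultimately show "linked a1 b1 (v - c) \<or> linked a2 b2 (v - c)"
        using s1C[OF c(1)] by (auto simp: linked_def)
    qed
    moreover have "v \<in> S"
      by (rule stable_set_combine[OF S s1(1) s2(1) v])
    ultimately show ?thesis by blast
  qed
qed

lemma clique_meets_stable_set:
  assumes C: "maximal_clique G C" and S: "maximal_stable_set G S"
    and cop: "coprime (a1 * b1) (a2 * b2)"
  shows "C \<inter> S \<noteq> {}"
proof -
  interpret sw: two_paired n a2 b2 a1 b1 by (rule swap)
  have "int a1 dvd x - y \<or> int a2 dvd x - y" if "x \<in> C" "y \<in> C" for x y
    using C that
    by (cases "x = y") (auto simp: maximal_clique_def clique_def arc_iff dest: linked_dvd)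
  from total_congruence_of_union[OF this] show ?thesis
  proof
    assume "\<forall>x\<in>C. \<forall>y\<in>C. int a1 dvd x - y"
    then show ?thesis using common_class_clique_meets_stable_set[OF C S cop] by blast
  next
    assume "\<forall>x\<in>C. \<forall>y\<in>C. int a2 dvd x - y"
    then show ?thesis
      using sw.common_class_clique_meets_stable_set[unfolded G_swap, OF C S] cop
      by (simp add: coprime_commute)
  qed
qed

subsection \<open>Moduli with a common factor\<close>

lemma clique_multiples:
  assumes "a1 > 0"
  shows "clique G ((\<lambda>k. int (k * a1)) ` {..<b1})"
  unfolding clique_def
proof (intro conjI ballI impI subsetI)
  fix x assume "x \<in> (\<lambda>k. int (k * a1)) ` {..<b1}"
  then obtain k where k: "k < b1" "x = int (k * a1)" by auto
  have "k * a1 < a1 * b1" using k(1) assms by simp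
  also have "\<dots> \<le> n" using dvd1 n_pos by (rule dvd_imp_le)
  finally show "x \<in> pverts G" using k(2) by (simp del: of_nat_mult)
next
  fix x y
  assume xy: "x \<in> (\<lambda>k. int (k * a1)) ` {..<b1}" "y \<in> (\<lambda>k. int (k * a1)) ` {..<b1}" "x \<noteq> y"
  then obtain k l where kl: "k < b1" "l < b1" "x = int (k * a1)" "y = int (l * a1)" by auto
  have le: "a1 * b1 \<le> n" using dvd1 n_pos by (rule dvd_imp_le)
  have "k * a1 < a1 * b1" "l * a1 < a1 * b1" using kl(1,2) assms by simp_all
  then have "k * a1 < n" "l * a1 < n" using le by linarith+
  then have rng: "x \<in> {0..<int n}" "y \<in> {0..<int n}" using kl by (simp_all del: of_nat_mult)
  have d: "x - y = int a1 * (int k - int l)" using kl by (simp add: algebra_simps)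
  have "\<not> int b1 dvd int k - int l"
  proof
    assume "int b1 dvd int k - int l"
    moreover have "int k - int l \<noteq> 0" using xy(3) kl(3,4) by auto
    ultimately have "int b1 \<le> \<bar>int k - int l\<bar>" using dvd_imp_le_int[of "int k - int l" "int b1"] by simp
    then show False using kl(1,2) by linarith
  qed
  then have "linked a1 b1 (x - y)"
    using assms by (simp add: linked_def d)
  then show "(x, y) \<in> parcs G" using rng by (simp add: arc_iff)
qed

text \<open>
  A vertex outside the class of \<open>0\<close> modulo \<open>a1\<close> would be joined to both \<open>0\<close> and \<open>a1\<close> by edges of the
  second type, forcing \<open>a2\<close> to divide \<open>a1\<close>.  Within that class, the member of the clique with the
  same residue modulo \<open>a1 * b1\<close> can only be reached by an edge of the second type.
\<close>

lemma clique_multiples_neighbour: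
  assumes "coprime a1 a2" "a1 > 0" "a2 > 1" "b1 > 1"
    and adj: "\<And>c. c \<in> (\<lambda>k. int (k * a1)) ` {..<b1} \<Longrightarrow> c \<noteq> x \<Longrightarrow> (x, c) \<in> parcs G"
  obtains k where "k < b1" "int a1 dvd x"
    "int (a1 * b1) dvd x - int (k * a1)" "int a2 dvd x - int (k * a1)"
proof -
  have adj': "linked a1 b1 (x - int (k * a1)) \<or> linked a2 b2 (x - int (k * a1))"
    if "k < b1" "int (k * a1) \<noteq> x" for k
    using adj[of "int (k * a1)"] that by (auto simp: arc_iff simp del: of_nat_mult)
  have a1x: "int a1 dvd x"
  proof (rule ccontr)
    assume no: "\<not> int a1 dvd x"
    have a2: "int a2 dvd x - int (k * a1)" if k: "k < b1" for k
    proof -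
      have "\<not> int a1 dvd x - int (k * a1)" using no by (simp add: dvd_diff_left_iff)
      moreover have "int (k * a1) \<noteq> x" using no by auto
      ultimately show ?thesis using adj'[OF k] linked_dvd by blast
    qed
    have "int a2 dvd (x - int (0 * a1)) - (x - int (1 * a1))"
      by (rule dvd_diff; rule a2) (use assms(4) in simp_all)
    then have "a2 dvd a1" by simp
    then show False
      using not_dvd_if_coprime[of a2 a1] assms(1,3) by (simp add: coprime_commute)
  qed
  then obtain q where q: "x = int a1 * q" by (rule dvdE)
  define k where "k = nat (q mod int b1)"
  have k: "k < b1" "int k = q mod int b1"
    using assms(4) by (auto simp: k_def nat_less_iff)
  have "x - int (k * a1) = int (a1 * b1) * (q div int b1)"
  proof -
    have "x - int (k * a1) = int a1 * (q - q mod int b1)"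
      by (simp add: q k(2) algebra_simps)
    then show ?thesis by (simp add: minus_mod_eq_mult_div)
  qed
  then have A1: "int (a1 * b1) dvd x - int (k * a1)" by simp
  then have "int a2 dvd x - int (k * a1)"
    using adj'[OF k(1)] by (cases "int (k * a1) = x") (auto simp: linked_def)
  then show thesis using that k(1) a1x A1 by blast
qed

text \<open>
  The vertices \<open>A\<^sub>1 = a1 * b1\<close> and \<open>a2\<close> differ both modulo \<open>a1\<close> and modulo \<open>a2\<close>, hence are
  not adjacent.  Of the vertices that belong or could be added to the clique of multiples of \<open>a1\<close>, the
  vertex \<open>A\<^sub>1\<close> is adjacent to all but those congruent to \<open>0\<close> modulo \<open>A\<^sub>1\<close>.  The latter are multiples of \<open>p\<close> and of \<open>a2\<close>, so they differ from \<open>a2\<close>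
  modulo \<open>a2 * p\<close> and are adjacent to \<open>a2\<close>.
\<close>

lemma not_CIS_common_prime:
  assumes cop: "coprime a1 a2" and gt: "a1 > 1" "a2 > 1" "b1 > 1"
    and p: "prime p" "p dvd a1 * b1" "p dvd b2" "\<not> p dvd a2"
    and nd: "\<not> a2 dvd b1"
  shows "\<not> CIS G"
proof (rule not_CIS_if_dominated)
  show "finite (pverts G)" by simp
  show "clique G ((\<lambda>k. int (k * a1)) ` {..<b1})"
    using gt by (intro clique_multiples) simp
  have a2A1: "\<not> a2 dvd a1 * b1"
    using nd cop by (simp add: coprime_commute coprime_dvd_mult_right_iff)
  have a1a2: "\<not> a1 dvd a2"
    using cop gt(1) by (rule not_dvd_if_coprime)
  have "a1 * b1 \<noteq> n" using a2A1 dvd2 dvd_mult_left by blast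
  then have A1n: "a1 * b1 < n" using dvd1 n_pos dvd_imp_le by (simp add: le_neq_implies_less)
  have "a2 \<noteq> n" using a1a2 dvd1 dvd_mult_left by blast
  moreover have "a2 dvd n" using dvd2 dvd_mult_left by blast
  ultimately have a2n: "a2 < n" using n_pos dvd_imp_le by (simp add: le_neq_implies_less)
  have nlink: "\<not> linked a1 b1 (int (a1 * b1) - int a2)" "\<not> linked a2 b2 (int (a1 * b1) - int a2)"
    using a1a2 a2A1 by (auto simp: linked_def dvd_diff_left_iff dvd_diff_right_iff
        simp flip: of_nat_mult)
  then show "stable_set G {int (a1 * b1), int a2}"
    using A1n a2n by (auto simp: stable_set_def arc_iff linked_commute simp del: of_nat_mult)
  fix x assume x: "x \<in> pverts G"
    and nb: "\<And>c. c \<in> (\<lambda>k. int (k * a1)) ` {..<b1} \<Longrightarrow> c \<noteq> x \<Longrightarrow> (x, c) \<in> parcs G"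
  have "a1 > 0" using gt(1) by simp
  from clique_multiples_neighbour[OF cop this gt(2,3) nb] obtain k where k: "k < b1" "int a1 dvd x"
    "int (a1 * b1) dvd x - int (k * a1)" "int a2 dvd x - int (k * a1)"
    by blast
  show "\<exists>s\<in>{int (a1 * b1), int a2}. (x, s) \<in> parcs G"
  proof (cases "int (a1 * b1) dvd x")
    case False
    then have "linked a1 b1 (x - int (a1 * b1))"
      using k(2) by (simp add: linked_def dvd_diff_left_iff)
    then show ?thesis using x A1n by (auto simp: arc_iff simp del: of_nat_mult)
  next
    case True
    then have "int (a1 * b1) dvd int (k * a1)"
      using k(3) by (metis dvd_diff_right_iff)
    then have "a1 * b1 dvd k * a1" by (simp only: int_dvd_int_iff)
    then have "b1 dvd k" using gt(1) by simp
    then have "k = 0" using k(1) nat_dvd_not_less[of k b1] by blast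
    then have a2x: "int a2 dvd x" using k(4) by simp
    have px: "int p dvd x"
      using True p(2) by (metis dvd_trans int_dvd_int_iff)
    have pa2: "coprime (int a2) (int p)"
      using prime_imp_coprime[OF p(1,4)] by (simp add: coprime_commute)
    have pax: "int (a2 * p) dvd x"
      using divides_mult[OF a2x px pa2] by simp
    have "\<not> int (a2 * b2) dvd x - int a2"
    proof
      assume "int (a2 * b2) dvd x - int a2"
      moreover have "int (a2 * p) dvd int (a2 * b2)"
        using p(3) by (metis int_dvd_int_iff mult_dvd_mono dvd_refl)
      ultimately have "int (a2 * p) dvd x - int a2" by (rule dvd_trans[rotated])
      then have "int (a2 * p) dvd int a2" using pax by (metis dvd_diff_right_iff)
      then have "a2 * p dvd a2 * 1" by (simp only: int_dvd_int_iff mult_1_right)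
      then have "p dvd 1" using gt(2) by (subst (asm) nat_mult_dvd_cancel1) simp_all
      then show False using p(1) by simp
    qed
    then have "linked a2 b2 (x - int a2)" using a2x by (simp add: linked_def)
    then show ?thesis using x a2n by (auto simp: arc_iff)
  qed
qed

text \<open>
  The stable set consists of vertices \<open>s\<^sub>w\<close>, one for each residue \<open>w\<close> modulo \<open>a2\<close>, with residue \<open>w + 1\<close>
  modulo \<open>a1\<close>: since \<open>a2 < a1\<close>, these are distinct and nonzero.  A vertex that is \<open>0\<close> modulo \<open>a1\<close> thus
  has an edge of the second type to the \<open>s\<^sub>w\<close> in its class modulo \<open>a2\<close>, the divisibility \<open>a1 dvd b2\<close>
  turning incongruence modulo \<open>a1\<close> into incongruence modulo \<open>a2 * b2\<close>.
\<close>

lemma not_CIS_mutual_dvd: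
  assumes cop: "coprime a1 a2" and gt: "a2 > 1" "b1 > 1" "a2 < a1" and dvd: "a1 dvd b2"
  shows "\<not> CIS G"
proof -
  have "\<exists>v\<in>{0..<int n}. int a2 dvd v - w \<and> int a1 dvd v - (w + 1)" for w
    using crt_in_interval[of "int a2" "int a1" "int n" w "w + 1"] cop moduli_dvd n_pos
    by (metis coprime_commute coprime_int_iff of_nat_0_less_iff)
  then obtain s where s: "\<And>w. s w \<in> {0..<int n}" "\<And>w. int a2 dvd s w - w"
    "\<And>w. int a1 dvd s w - (w + 1)" by metis
  show ?thesis
  proof (rule not_CIS_if_dominated)
    show "finite (pverts G)" by simp
    show "clique G ((\<lambda>k. int (k * a1)) ` {..<b1})"
      using gt by (intro clique_multiples) simp
    show "stable_set G (s ` {0..<int a2})"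
      unfolding stable_set_def
    proof (intro conjI ballI)
      show "s ` {0..<int a2} \<subseteq> pverts G" using s(1) by auto
      fix u v assume "u \<in> s ` {0..<int a2}" "v \<in> s ` {0..<int a2}"
      then obtain i j where ij: "i \<in> {0..<int a2}" "j \<in> {0..<int a2}" "u = s i" "v = s j" by auto
      have eq: "i = j" if "m dvd i - j" "m \<ge> int a2" for m
      proof (rule ccontr)
        assume "i \<noteq> j"
        then have "m \<le> \<bar>i - j\<bar>" using that(1) dvd_imp_le_int[of "i - j" m] by auto
        then show False using that(2) ij(1,2) by auto
      qed
      have "int a2 dvd i - j" if "int a2 dvd u - v"
      proof -
        have "int a2 dvd i - s i" using s(2) dvd_diff_commute by blast
        then show ?thesis using that ij(3,4) s(2) dvd_diff_trans by blast
      qed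
      moreover have "int a1 dvd i - j" if "int a1 dvd u - v"
      proof -
        have "int a1 dvd (i + 1) - s i" using s(3) dvd_diff_commute by blast
        then have "int a1 dvd (i + 1) - (j + 1)"
          using that ij(3,4) s(3) dvd_diff_trans by blast
        then show ?thesis by simp
      qed
      ultimately have "u = v" if "linked a1 b1 (u - v) \<or> linked a2 b2 (u - v)"
        using that eq[of "int a1"] eq[of "int a2"] gt(3) ij(3,4) linked_dvd[of a1 b1 "u - v"]
          linked_dvd[of a2 b2 "u - v"] by (metis less_imp_le of_nat_le_iff order_refl)
      then show "(u, v) \<notin> parcs G" by (auto simp: arc_iff)
    qed
    fix x assume x: "x \<in> pverts G"
      and nb: "\<And>c. c \<in> (\<lambda>k. int (k * a1)) ` {..<b1} \<Longrightarrow> c \<noteq> x \<Longrightarrow> (x, c) \<in> parcs G"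
    have "a1 > 0" using gt(3) by simp
    from clique_multiples_neighbour[OF cop this gt(1,2) nb] have a1x: "int a1 dvd x" by blast
    define w where "w = x mod int a2"
    have w: "0 \<le> w" "w < int a2" using gt(1) by (simp_all add: w_def)
    have "int a2 dvd x - w" by (simp add: w_def minus_mod_eq_mult_div)
    moreover have "int a2 dvd w - s w" using s(2) dvd_diff_commute by blast
    ultimately have a2: "int a2 dvd x - s w" by (rule dvd_diff_trans)
    have "\<not> int (a2 * b2) dvd x - s w"
    proof
      assume "int (a2 * b2) dvd x - s w"
      moreover have "int a1 dvd int (a2 * b2)" using dvd by simp
      ultimately have "int a1 dvd x - s w" by (rule dvd_trans[rotated])
      then have "int a1 dvd x - (w + 1)" using s(3) by (rule dvd_diff_trans)
      then have "int a1 dvd w + 1" using a1x by (metis dvd_diff_right_iff)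
      then have "int a1 \<le> w + 1" using w(1) by (intro zdvd_imp_le) simp_all
      then show False using w(2) gt(3) by linarith
    qed
    then have "(x, s w) \<in> parcs G"
      using a2 x s(1) by (auto simp: arc_iff linked_def)
    then show "\<exists>t\<in>s ` {0..<int a2}. (x, t) \<in> parcs G" using w by auto
  qed
qed

section \<open>Connectedness and the parameters\<close>

lemma parameter_one_if_connected:
  assumes "n > 1" "graph_connected G"
    and "\<And>d. linked a1 b1 d \<or> linked a2 b2 d \<Longrightarrow> int m dvd d"
  shows "m = 1"
proof -
  have "int m dvd 1 - 0"
    by (rule graph_connected_dvd_diff[OF assms(2)]) (use assms in \<open>auto simp: arc_iff\<close>)
  then show ?thesis by simp
qed

lemma parameter_one_if_co_connected:
  assumes "n > 1" "co_connected G"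
    and "\<And>d. \<not> linked a1 b1 d \<Longrightarrow> \<not> linked a2 b2 d \<Longrightarrow> int m dvd d"
  shows "m = 1"
proof -
  have "int m dvd 1 - 0"
    by (rule graph_connected_dvd_diff[OF assms(2)[unfolded co_connected_def]])
      (use assms in \<open>auto simp: graph_complement_def arc_iff\<close>)
  then show ?thesis by simp
qed

text \<open>
  Every edge preserves the class modulo \<open>gcd a1 a2\<close>, so connectedness makes this \<open>1\<close>.
  If \<open>b1 = 1\<close>, there are no edges of the first type; if \<open>a1 = 1\<close>, non-adjacent vertices agree modulo
  \<open>b1\<close>.  Each value \<open>1\<close> thus propagates until no edges are left.
\<close>

lemma parameters_if_connected_co_connected:
  assumes n: "n > 1" and conn: "graph_connected G" and co: "co_connected G"
  shows "coprime a1 a2" "a1 > 1" "b1 > 1" "a2 > 1" "b2 > 1"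
proof -
  have "int (gcd a1 a2) dvd d" if "linked a1 b1 d \<or> linked a2 b2 d" for d
  proof -
    have "int (gcd a1 a2) dvd int a1" "int (gcd a1 a2) dvd int a2"
      by (simp_all only: int_dvd_int_iff gcd_dvd1 gcd_dvd2)
    then show ?thesis using that linked_dvd dvd_trans by blast
  qed
  then have "gcd a1 a2 = 1"
    by (rule parameter_one_if_connected[OF n conn])
  then show "coprime a1 a2" by (simp add: coprime_iff_gcd_eq_1)
  have 1: "a2 = 1" if "b1 = 1"
    by (rule parameter_one_if_connected[OF n conn]) (use that in \<open>auto simp: linked_def\<close>)
  have 2: "a1 = 1" if "b2 = 1"
    by (rule parameter_one_if_connected[OF n conn]) (use that in \<open>auto simp: linked_def\<close>)
  have 3: "b1 = 1" if "a1 = 1"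
    by (rule parameter_one_if_co_connected[OF n co]) (use that in \<open>auto simp: linked_def\<close>)
  have 4: "b2 = 1" if "a2 = 1"
    by (rule parameter_one_if_co_connected[OF n co]) (use that in \<open>auto simp: linked_def\<close>)
  have "\<not> (b1 = 1 \<and> b2 = 1)"
  proof
    (* without edges, every number divides all differences of adjacent vertices *)
    assume "b1 = 1 \<and> b2 = 1"
    then have "(0::nat) = 1"
      by (intro parameter_one_if_connected[OF n conn]) (auto simp: linked_def)
    then show False by simp
  qed
  then have "a1 \<noteq> 1" "b1 \<noteq> 1" "a2 \<noteq> 1" "b2 \<noteq> 1" using 1 2 3 4 by blast+
  moreover have "a1 \<noteq> 0" "b1 \<noteq> 0" "a2 \<noteq> 0" "b2 \<noteq> 0" using dvd1 dvd2 n_pos by auto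
  ultimately show "a1 > 1" "b1 > 1" "a2 > 1" "b2 > 1" by simp_all
qed

lemma not_CIS_if_not_coprime:
  assumes conn: "graph_connected G" and co: "co_connected G"
    and ncop: "\<not> coprime (a1 * b1) (a2 * b2)"
  shows "\<not> CIS G"
proof -
  interpret sw: two_paired n a2 b2 a1 b1 by (rule swap)
  have "n \<noteq> 1" using ncop dvd1 by auto
  then have n: "n > 1" using n_pos by simp
  note par = parameters_if_connected_co_connected[OF n conn co]
  have cop': "coprime a2 a1" using par(1) by (simp add: coprime_commute)
  note L1 = not_CIS_common_prime[OF par(1,2,4,3)]
  note L2 = sw.not_CIS_common_prime[OF cop' par(4,2,5), unfolded G_swap]
  have not_both: "\<not> q dvd a2" if "prime q" "q dvd a1" for q
    using par(1) that coprime_common_divisor not_prime_unit by blast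
  show ?thesis
  proof (cases "a2 dvd b1"; cases "a1 dvd b2")
    assume nd: "\<not> a2 dvd b1" "\<not> a1 dvd b2"
    obtain p where p: "prime p" "p dvd a1 * b1" "p dvd a2 * b2"
      using ncop prime_factor_nat[of "gcd (a1 * b1) (a2 * b2)"] by (auto simp: coprime_iff_gcd_eq_1)
    show ?thesis
    proof (cases "p dvd a2")
      case False
      then have "p dvd b2" using p by (simp add: prime_dvd_mult_iff)
      then show ?thesis using L1 p(1,2) False nd(1) by simp
    next
      case True
      then have "\<not> p dvd a1" using not_both[OF p(1)] by auto
      moreover from this have "p dvd b1" using p by (simp add: prime_dvd_mult_iff)
      ultimately show ?thesis using L2 p(1,3) nd(2) by simp
    qed
  next
    assume d: "a2 dvd b1" "\<not> a1 dvd b2"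
    obtain q where q: "prime q" "q dvd a2" using par(4) prime_factor_nat[of a2] by auto
    have "\<not> q dvd a1" using not_both[OF q(1)] q(2) by auto
    moreover have "q dvd b1" using q(2) d(1) by (rule dvd_trans)
    ultimately show ?thesis using L2[of q] q d(2) by simp
  next
    assume d: "\<not> a2 dvd b1" "a1 dvd b2"
    obtain q where q: "prime q" "q dvd a1" using par(2) prime_factor_nat[of a1] by auto
    have "\<not> q dvd a2" using not_both[OF q] .
    moreover have "q dvd b2" using q(2) d(2) by (rule dvd_trans)
    ultimately show ?thesis using L1[of q] q d(1) by simp
  next
    assume d: "a2 dvd b1" "a1 dvd b2"
    have "a1 \<noteq> a2" using par(1,2) by auto
    then consider "a2 < a1" | "a1 < a2" by linarith
    then show ?thesis
      using not_CIS_mutual_dvd[OF par(1,4,3)] sw.not_CIS_mutual_dvd[OF cop' par(2,5), unfolded G_swap] d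
      by cases simp_all
  qed
qed

end

theorem theorem4:
  fixes n a1 b1 a2 b2 :: nat
  assumes "n > 0" "a1 > 0" "b1 > 0" "a2 > 0" "b2 > 0"
    and "a1 * b1 dvd n" and "a2 * b2 dvd n"
    and "graph_connected (two_paired_circulant n a1 b1 a2 b2)"
    and "co_connected (two_paired_circulant n a1 b1 a2 b2)"
  shows "CIS (two_paired_circulant n a1 b1 a2 b2) \<longleftrightarrow> gcd (a1 * b1) (a2 * b2) = 1"
proof -
  interpret two_paired n a1 b1 a2 b2
    using assms by unfold_locales
  have "CIS G" if "coprime (a1 * b1) (a2 * b2)"
    unfolding CIS_def using clique_meets_stable_set that by blast
  then show ?thesis
    using not_CIS_if_not_coprime[OF assms(8,9)] by (auto simp: coprime_iff_gcd_eq_1)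
qed

end
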